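(* Let $1 \le p < 2$ and let $\gamma : [0,1] \to \mathbb{R}^2$ be a continuous closed curve (i.e. $\gamma_0 = \gamma_1$) with finite $p$-variation, $\|\gamma\|_{p,[0,1]} < \infty$. Then for all $q \in [1, \frac{2}{p})$, $$\left(\iint_{\mathbb{R}^2} |\eta(\gamma,(x,y))|^q \,dx\,dy\right)^{1/q} \le \left(\frac12\right)^{\frac1q}\left(\zeta\left(\frac{2}{pq}\right)-1\right)\left(\|\gamma\|_{p,[0,1]}\right)^{\frac{2}{q}},$$ where $\eta(\gamma,(x,y))$ is the winding number of $\gamma$ at $(x,y)$, $\zeta$ is the Riemann zeta function, and $\|\gamma\|_{p,[0,1]}$ is the $p$-variation of $\gamma$ on $[0,1]$.
   Context: A partition of $[0,1]$ is a finite tuple $(t_0,\dots,t_r)$ with $0 = t_0 < t_1 < \dots < t_r = 1$. For $p \ge 1$ and a continuous $\gamma:[0,1]\to\mathbb{R}^2$, the $p$-variation of $\gamma$ on $[0,1]$ is $$\|\gamma\|_{p,[0,1]} = \left(\sup\left\{\sum_{j=0}^{r-1} |\gamma_{t_j}-\gamma_{t_{j+1}}|^p : (t_0,\dots,t_r) \text{ is a partition of } [0,1]\right\}\right)^{1/p},$$ with $|\cdot|$ the Euclidean norm. Winding number: for a continuous closed path $\gamma:[0,1]\to\mathbb{R}^2$ and $(x,y)\in\mathbb{R}^2\setminus\gamma[0,1]$, let $S^\gamma_t = \frac{\gamma_t-(x,y)}{|\gamma_t-(x,y)|}$, and let $\theta^\gamma:[0,1]\to\mathbb{R}$ be a (continuous)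 lift of $S^\gamma$, so that $S^\gamma_t=(\cos\theta^\gamma_t,\sin\theta^\gamma_t)$ for all $t \in [0,1]$. Then $\eta(\gamma,(x,y)) = \frac{\theta^\gamma(1)-\theta^\gamma(0)}{2\pi}$, which does not depend on the choice of lift. Since $\eta(\gamma,\cdot)$ is defined only off the image of $\gamma$, the integral is understood over $\mathbb{R}^2\setminus\gamma[0,1]$. *)

theory Defs
  imports "HOL-Analysis.Analysis"
begin

definition unit_partition :: "nat \<Rightarrow> (nat \<Rightarrow> real) \<Rightarrow> bool" where
  "unit_partition r t \<longleftrightarrow> t 0 = 0 \<and> t r = 1 \<and> (\<forall>j<r. t j < t (Suc j))"

definition variation_sums :: "real \<Rightarrow> (real \<Rightarrow> 'a::real_normed_vector) \<Rightarrow> real set" where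
  "variation_sums p \<gamma> =
     {(\<Sum>j<r. norm (\<gamma> (t j) - \<gamma> (t (Suc j))) powr p) | r t. unit_partition r t}"

text \<open>
  The supremum is taken in the reals, so finiteness of the \<open>p\<close>-variation is the separate
  predicate below, and \<open>p_variation\<close> is meaningful only when it holds.
\<close>

definition finite_p_variation :: "real \<Rightarrow> (real \<Rightarrow> 'a::real_normed_vector) \<Rightarrow> bool" where
  "finite_p_variation p \<gamma> \<longleftrightarrow> bdd_above (variation_sums p \<gamma>)"

definition p_variation :: "real \<Rightarrow> (real \<Rightarrow> 'a::real_normed_vector) \<Rightarrow> real" where
  "p_variation p \<gamma> = (Sup (variation_sums p \<gamma>)) powr (1 / p)"

text \<open>
  The plane is \<open>real \<times> real\<close>, whose norm is Euclidean.
\<close>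

definition angle_lift :: "(real \<Rightarrow> real \<times> real) \<Rightarrow> real \<times> real \<Rightarrow> (real \<Rightarrow> real) \<Rightarrow> bool" where
  "angle_lift \<gamma> z \<theta> \<longleftrightarrow> continuous_on {0..1} \<theta> \<and>
     (\<forall>t\<in>{0..1}. (\<gamma> t - z) /\<^sub>R norm (\<gamma> t - z) = (cos (\<theta> t), sin (\<theta> t)))"

definition planar_winding_number :: "(real \<Rightarrow> real \<times> real) \<Rightarrow> real \<times> real \<Rightarrow> real" where
  "planar_winding_number \<gamma> z =
     (THE w. \<exists>\<theta>. angle_lift \<gamma> z \<theta> \<and> w = (\<theta> 1 - \<theta> 0) / (2 * pi))"

text \<open>
  The definite description is justified by the next three lemmas: off the image of a path
  a lift exists, and the normalised increment does not depend on the lift.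
\<close>

lemma angle_lift_exists:
  assumes "path \<gamma>" and "z \<notin> path_image \<gamma>"
  shows "\<exists>\<theta>. angle_lift \<gamma> z \<theta>"
proof -
  define h where "h = (\<lambda>t. Complex (fst (\<gamma> t - z)) (snd (\<gamma> t - z)))"
  have cont: "continuous_on {0..1} \<gamma>"
    using assms(1) by (simp add: path_def)
  have "continuous_on {0..1} h"
    unfolding h_def Complex_eq by (intro continuous_intros cont)
  moreover have nz: "\<gamma> t - z \<noteq> 0" if "t \<in> {0..1}" for t
    using assms(2) that by (auto simp: path_image_def)
  moreover have "h t \<noteq> 0" if "t \<in> {0..1}" for t
    using nz[OF that] by (auto simp: h_def complex_eq_iff prod_eq_iff)
  ultimately obtain g where g: "continuous_on {0..1} g" "\<And>t. t \<in> {0..1} \<Longrightarrow> h t = exp (g t)"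
    using continuous_logarithm_on_contractible[of "{0..1}" h] convex_imp_contractible
    by (metis convex_real_interval(5))
  have "(\<gamma> t - z) /\<^sub>R norm (\<gamma> t - z) = (cos (Im (g t)), sin (Im (g t)))" if "t \<in> {0..1}" for t
  proof -
    have "norm (\<gamma> t - z) = norm (h t)"
      by (simp add: h_def norm_prod_def cmod_def)
    also have "\<dots> = exp (Re (g t))"
      using g(2)[OF that] by simp
    finally have n: "norm (\<gamma> t - z) = exp (Re (g t))" .
    have "fst (\<gamma> t - z) = exp (Re (g t)) * cos (Im (g t))"
         "snd (\<gamma> t - z) = exp (Re (g t)) * sin (Im (g t))"
      using arg_cong[OF g(2)[OF that], of Re] arg_cong[OF g(2)[OF that], of Im]
      by (simp_all add: h_def Re_exp Im_exp)
    then show ?thesis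
      unfolding n by (simp add: prod_eq_iff)
  qed
  moreover have "continuous_on {0..1} (\<lambda>t. Im (g t))"
    by (intro continuous_intros g(1))
  ultimately show ?thesis
    unfolding angle_lift_def by blast
qed

lemma angle_lift_unique:
  assumes "angle_lift \<gamma> z \<theta>" and "angle_lift \<gamma> z \<theta>'"
  shows "\<theta> 1 - \<theta> 0 = \<theta>' 1 - \<theta>' 0"
proof -
  define f where "f = (\<lambda>t. (\<theta> t - \<theta>' t) / (2 * pi))"
  have int: "f t \<in> \<int>" if "t \<in> {0..1}" for t
  proof -
    have "sin (\<theta> t) = sin (\<theta>' t) \<and> cos (\<theta> t) = cos (\<theta>' t)"
      using assms that by (metis angle_lift_def prod.inject)
    then obtain n :: int where "\<theta> t = \<theta>' t + 2 * pi * n"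
      using sin_cos_eq_iff by blast
    then show ?thesis
      by (simp add: f_def)
  qed
  have "f constant_on {0..1}"
  proof (rule continuous_discrete_range_constant)
    show "continuous_on {0..1} f"
      using assms unfolding f_def angle_lift_def by (intro continuous_intros) auto
    fix x :: real assume x: "x \<in> {0..1}"
    have "1 \<le> norm (f y - f x)" if "y \<in> {0..1} \<and> f y \<noteq> f x" for y
      using int[OF x] int[of y] that by (simp add: Ints_nonzero_abs_ge1)
    then show "\<exists>e>0. \<forall>y. y \<in> {0..1} \<and> f y \<noteq> f x \<longrightarrow> e \<le> norm (f y - f x)"
      by (intro exI[of _ 1]) auto
  qed auto
  then have "f 1 = f 0"
    by (auto simp: constant_on_def)
  then show ?thesis
    by (simp add: f_def)
qed

lemma planar_winding_number_eq:
  assumes "angle_lift \<gamma> z \<theta>"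
  shows "planar_winding_number \<gamma> z = (\<theta> 1 - \<theta> 0) / (2 * pi)"
  unfolding planar_winding_number_def using assms angle_lift_unique by (intro the_equality) metis+

text \<open>
  The Riemann zeta function at a real argument \<open>s > 1\<close>, where the Dirichlet series converges.
\<close>

definition zeta_real :: "real \<Rightarrow> real" where
  "zeta_real s = (\<Sum>n. 1 / real (Suc n) powr s)"

end

theory Submission
  imports Defs
begin

text \<open>
  The proof runs Young's argument for the existence of the integral of functions of finite
  \<open>p\<close>-variation on the winding number itself. A polygon inscribed in the curve can be reduced to a
  trivial one by deleting its interior points one at a time. Deleting a point \<open>b\<close> between its neighbours
  \<open>a\<close> and \<open>c\<close> changes the winding number by that of the triangle \<open>a b c\<close>, which is at most \<open>1\<close> in
  absolute value and vanishes off the triangle (\<open>polygon_turn_omit\<close>). When \<open>k\<close> interior points are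
  left, one of them has \<open>norm (a - b) * norm (b - c) \<le> V\<^sup>2 * k powr (- (2 / p))\<close>, where \<open>V\<close> is the
  \<open>p\<close>-variation, since by the inequality of the arithmetic and geometric means the adjacent products
  cannot all be large (\<open>exists_consecutive_product_le\<close>). The area of the triangle is at most half of
  that. Hence its indicator function has \<open>L\<^sup>q\<close> norm at most
  \<open>(1 / 2) powr (1 / q) * V powr (2 / q) * k powr (- (2 / (p * q)))\<close>, and summing over \<open>k \<ge> 2\<close> by
  Minkowski's inequality (\<open>nn_integral_card_powr_le\<close>) gives the stated bound for every inscribed
  polygon, with a constant independent of the number of vertices (\<open>nn_integral_polygon_turn_le\<close>).

  At each point off the curve, the winding number is computed exactly by all inscribed polygons of
  sufficiently small mesh (\<open>planar_winding_number_eventually_polygon_turn\<close>). It is therefore a pointwise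
  limit of measurable functions, and the bound passes to it by Fatou's lemma.

  The winding number of a polygon is treated as a sum of signed angles, taken so that the angle is
  antisymmetric and defined for all pairs of vectors. All estimates then hold at every point of the
  plane, including the points on the edges of polygons and triangles.
\<close>

section \<open>Signed angles and triangles\<close>

text \<open>
  If \<open>u\<close> and \<open>v\<close> have polar angles \<open>\<alpha>\<close> and \<open>\<beta>\<close>, the quotient below is
  \<open>sin (\<beta> - \<alpha>) / (1 + cos (\<beta> - \<alpha>)) = tan ((\<beta> - \<alpha>) / 2)\<close>, so the value is \<open>\<beta> - \<alpha>\<close> brought into
  \<open>(-\<pi>, \<pi>)\<close>. Opposite vectors make the denominator vanish, and division by zero assigns them the
  angle \<open>0\<close>. This is what makes the angle antisymmetric everywhere, which the principal argument,
  with its value \<open>\<pi>\<close> on the negative axis, is not.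
\<close>

definition signed_angle :: "real \<times> real \<Rightarrow> real \<times> real \<Rightarrow> real" where
  "signed_angle u v = 2 * arctan ((fst u * snd v - snd u * fst v) / (norm u * norm v + u \<bullet> v))"

lemma signed_angle_swap: "signed_angle v u = - signed_angle u v"
proof -
  have "fst v * snd u - snd v * fst u = - (fst u * snd v - snd u * fst v)"
    by simp
  then show ?thesis
    unfolding signed_angle_def
    by (simp only: minus_divide_left [symmetric] arctan_minus mult_minus_right
        inner_commute [of v] mult.commute [of "norm v"])
qed

lemma abs_signed_angle_less_pi: "\<bar>signed_angle u v\<bar> < pi"
  unfolding signed_angle_def using arctan_bounded by (simp add: abs_less_iff) (smt (verit) field_sum_of_halves)

lemma signed_angle_polar:
  assumes "r > 0" "s > 0"
  shows "signed_angle (r * cos \<alpha>, r * sin \<alpha>) (s * cos \<beta>, s * sin \<beta>) = 2 * arctan (tan ((\<beta> - \<alpha>) / 2))"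
proof -
  have norm: "norm (t * cos x, t * sin x) = t" if "t > 0" for t x :: real
    using that by (simp add: norm_prod_def power_mult_distrib flip: distrib_left)
  have two: "2 * ((\<beta> - \<alpha>) / 2) = \<beta> - \<alpha>"
    by (rule mult_2 [THEN trans]) (rule field_sum_of_halves)
  have "signed_angle (r * cos \<alpha>, r * sin \<alpha>) (s * cos \<beta>, s * sin \<beta>)
      = 2 * arctan ((r * s) * sin (\<beta> - \<alpha>) / ((r * s) * (cos (\<beta> - \<alpha>) + 1)))"
    unfolding signed_angle_def
    by (simp add: norm assms inner_prod_def sin_diff cos_diff algebra_simps)
  also have "\<dots> = 2 * arctan (tan ((\<beta> - \<alpha>) / 2))"
    unfolding tan_half two using assms by simp
  finally show ?thesis .
qed

lemma signed_angle_polar_eq: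
  assumes "r > 0" "s > 0" "\<bar>\<beta> - \<alpha>\<bar> < pi"
  shows "signed_angle (r * cos \<alpha>, r * sin \<alpha>) (s * cos \<beta>, s * sin \<beta>) = \<beta> - \<alpha>"
  using assms by (simp add: signed_angle_polar arctan_tan abs_less_iff)

lemma signed_angle_polar_cong:
  assumes "r > 0" "s > 0"
    and "signed_angle (r * cos \<alpha>, r * sin \<alpha>) (s * cos \<beta>, s * sin \<beta>) \<noteq> 0"
  obtains k :: int
  where "signed_angle (r * cos \<alpha>, r * sin \<alpha>) (s * cos \<beta>, s * sin \<beta>) = \<beta> - \<alpha> + of_int k * (2 * pi)"
proof -
  have "cos ((\<beta> - \<alpha>) / 2) \<noteq> 0"
    using assms by (auto simp: signed_angle_polar tan_def)
  then obtain k where "arctan (tan ((\<beta> - \<alpha>) / 2)) = (\<beta> - \<alpha>) / 2 - of_int k * pi"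
    by (rule arctan_tan_eq_abs_pi)
  then show ?thesis
    using assms by (intro that[of "- k"]) (simp add: signed_angle_polar)
qed

lemma polar_form:
  fixes u :: "real \<times> real"
  assumes "u \<noteq> 0"
  obtains r \<alpha> where "r > 0" "u = (r * cos \<alpha>, r * sin \<alpha>)"
proof -
  have "(fst u / norm u)\<^sup>2 + (snd u / norm u)\<^sup>2 = 1"
    using assms by (simp add: power_divide norm_prod_def prod_eq_iff flip: add_divide_distrib)
  then obtain t where "fst u / norm u = cos t" "snd u / norm u = sin t"
    by (rule sincos_total_2pi)
  then have "fst u = norm u * cos t" "snd u = norm u * sin t"
    using assms by (simp_all add: divide_eq_eq mult.commute)
  then show ?thesis
    using assms by (metis that zero_less_norm_iff prod.collapse)
qed

text \<open>
  The total turn around a triangle is \<open>2 * \<pi>\<close> times the winding number of the triangle as long as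
  the origin is on no side; it is then a multiple of \<open>2 * \<pi>\<close> smaller than \<open>3 * \<pi>\<close> in absolute
  value. If the origin is on a side, that side contributes \<open>0\<close> and only two angles remain. Having
  the bound for every position of the origin spares all null-set arguments about the edges.
\<close>

lemma triangle_turn_le:
  "\<bar>signed_angle u v + signed_angle v w + signed_angle w u\<bar> \<le> 2 * pi"
proof (cases "signed_angle u v = 0 \<or> signed_angle v w = 0 \<or> signed_angle w u = 0")
  case True
  then show ?thesis
    using abs_signed_angle_less_pi[of u v] abs_signed_angle_less_pi[of v w]
      abs_signed_angle_less_pi[of w u] by linarith
next
  case False
  then have "u \<noteq> 0" "v \<noteq> 0" "w \<noteq> 0"
    by (auto simp: signed_angle_def)
  then obtain r \<alpha> s \<beta> t \<delta> where rst: "r > 0" "s > 0" "t > 0"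
    and eqs: "u = (r * cos \<alpha>, r * sin \<alpha>)" "v = (s * cos \<beta>, s * sin \<beta>)" "w = (t * cos \<delta>, t * sin \<delta>)"
    by (metis polar_form)
  obtain k l m :: int where "signed_angle u v = \<beta> - \<alpha> + of_int k * (2 * pi)"
    "signed_angle v w = \<delta> - \<beta> + of_int l * (2 * pi)"
    "signed_angle w u = \<alpha> - \<delta> + of_int m * (2 * pi)"
    using False rst unfolding eqs by (metis signed_angle_polar_cong)
  then have sum: "signed_angle u v + signed_angle v w + signed_angle w u = of_int (k + l + m) * (2 * pi)"
    by (simp add: algebra_simps)
  moreover have "\<bar>signed_angle u v + signed_angle v w + signed_angle w u\<bar> < 3 * pi"
    using abs_signed_angle_less_pi[of u v] abs_signed_angle_less_pi[of v w]
      abs_signed_angle_less_pi[of w u] by linarith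
  ultimately have "\<bar>real_of_int (k + l + m)\<bar> * 2 * pi < 3 * pi"
    by (simp add: abs_mult)
  then have "\<bar>real_of_int (k + l + m)\<bar> < 2"
    by simp
  then have "\<bar>k + l + m\<bar> \<le> 1"
    by linarith
  then have "\<bar>real_of_int (k + l + m)\<bar> \<le> 1"
    by linarith
  then show ?thesis
    unfolding sum abs_mult using pi_gt_zero by (simp add: mult_le_cancel_right1)
qed

lemma polar_form_half_plane:
  fixes n u :: "real \<times> real"
  assumes "n = (m * cos \<phi>, m * sin \<phi>)" "m > 0" "n \<bullet> u > 0"
  obtains r \<alpha> where "r > 0" "\<bar>\<alpha> - \<phi>\<bar> < pi / 2" "u = (r * cos \<alpha>, r * sin \<alpha>)"
proof -
  define x y where "x = fst u * cos \<phi> + snd u * sin \<phi>" and "y = snd u * cos \<phi> - fst u * sin \<phi>"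
  have "n \<bullet> u = m * x"
    using assms(1) by (simp add: x_def inner_prod_def algebra_simps)
  then have x: "x > 0"
    using assms by (simp add: zero_less_mult_iff)
  define a r where "a = arctan (y / x)" and "r = sqrt (x\<^sup>2 + y\<^sup>2)"
  have r: "r = x * sqrt (1 + (y / x)\<^sup>2)"
  proof -
    have "x\<^sup>2 + y\<^sup>2 = x\<^sup>2 * (1 + (y / x)\<^sup>2)"
      using x by (simp add: field_simps)
    then show ?thesis
      unfolding r_def using x by (simp add: real_sqrt_mult)
  qed
  have sq: "sqrt (1 + (y / x)\<^sup>2) > 0"
    by (simp add: add_pos_nonneg)
  have "r * cos a = x" "r * sin a = y"
    unfolding r a_def cos_arctan sin_arctan using sq x by auto
  moreover have "fst u = x * cos \<phi> - y * sin \<phi>" "snd u = x * sin \<phi> + y * cos \<phi>"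
    using sin_cos_squared_add[of \<phi>] unfolding x_def y_def by algebra+
  ultimately have "fst u = (r * cos a) * cos \<phi> - (r * sin a) * sin \<phi>"
    "snd u = (r * cos a) * sin \<phi> + (r * sin a) * cos \<phi>"
    by simp_all
  then have "fst u = r * cos (\<phi> + a)" "snd u = r * sin (\<phi> + a)"
    by (simp_all add: cos_add sin_add algebra_simps)
  then have "u = (r * cos (\<phi> + a), r * sin (\<phi> + a))"
    by (metis prod.collapse)
  moreover have "r > 0"
    using r x sq by simp
  moreover have "\<bar>\<phi> + a - \<phi>\<bar> < pi / 2"
    using arctan_bounded[of "y / x"] unfolding a_def by linarith
  ultimately show ?thesis
    by (rule that[rotated 2])
qed

text \<open>
  Inside an open half plane the polar angle has a continuous branch of oscillation less than \<open>\<pi>\<close>,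
  and every signed angle is the difference of its values, so the sum telescopes.
\<close>

lemma triangle_turn_half_plane:
  assumes "n \<bullet> u > 0" "n \<bullet> v > 0" "n \<bullet> w > 0"
  shows "signed_angle u v + signed_angle v w + signed_angle w u = 0"
proof -
  have "n \<noteq> 0"
    using assms by auto
  then obtain m \<phi> where n: "m > 0" "n = (m * cos \<phi>, m * sin \<phi>)"
    by (rule polar_form)
  obtain r \<alpha> where u: "r > 0" "\<bar>\<alpha> - \<phi>\<bar> < pi / 2" "u = (r * cos \<alpha>, r * sin \<alpha>)"
    using polar_form_half_plane[OF n(2,1) assms(1)] .
  obtain s \<beta> where v: "s > 0" "\<bar>\<beta> - \<phi>\<bar> < pi / 2" "v = (s * cos \<beta>, s * sin \<beta>)"
    using polar_form_half_plane[OF n(2,1) assms(2)] .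
  obtain t \<delta> where w: "t > 0" "\<bar>\<delta> - \<phi>\<bar> < pi / 2" "w = (t * cos \<delta>, t * sin \<delta>)"
    using polar_form_half_plane[OF n(2,1) assms(3)] .
  have "\<bar>\<beta> - \<alpha>\<bar> < pi" "\<bar>\<delta> - \<beta>\<bar> < pi" "\<bar>\<alpha> - \<delta>\<bar> < pi"
    using u(2) v(2) w(2) by linarith+
  then show ?thesis
    using u v w by (simp add: signed_angle_polar_eq)
qed

lemma triangle_turn_outside:
  assumes "z \<notin> convex hull {a, b, c}"
  shows "signed_angle (a - z) (b - z) + signed_angle (b - z) (c - z) + signed_angle (c - z) (a - z) = 0"
proof -
  have "closed (convex hull {a, b, c})"
    by (simp add: compact_imp_closed finite_imp_compact_convex_hull)
  then obtain n d where n: "n \<bullet> z < d" "\<And>x. x \<in> convex hull {a, b, c} \<Longrightarrow> n \<bullet> x > d"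
    using separating_hyperplane_closed_point[OF convex_convex_hull _ assms] by blast
  have "n \<bullet> (x - z) > 0" if "x \<in> {a, b, c}" for x
    using n(1) n(2)[of x] that hull_inc[of x "{a, b, c}" convex] by (simp add: inner_diff_right)
  then show ?thesis
    by (intro triangle_turn_half_plane[of n]) auto
qed

section \<open>The area of a triangle\<close>

text \<open>
  The formula \<open>content_triangle\<close> concerns \<^typ>\<open>real ^ 2\<close>; it is transferred to pairs along this isometry.
\<close>

lemma lborel_pair_eq_distr_vec:
  "(lborel :: (real \<times> real) measure) = distr lborel borel (\<lambda>x :: real ^ 2. (x $ 1, x $ 2))"
proof (rule lborel_eqI)
  have [measurable]: "(\<lambda>x :: real ^ 2. (x $ 1, x $ 2)) \<in> borel_measurable borel"
    by (intro borel_measurable_continuous_onI continuous_intros)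
  fix l u :: "real \<times> real" assume lu: "\<And>b. b \<in> Basis \<Longrightarrow> l \<bullet> b \<le> u \<bullet> b"
  have 1: "fst l \<le> fst u" "snd l \<le> snd u"
    using lu[of "(1, 0)"] lu[of "(0, 1)"] by (auto simp: Basis_prod_def inner_prod_def)
  have vimage: "(\<lambda>x :: real ^ 2. (x $ 1, x $ 2)) -` box l u = box (vector [fst l, snd l]) (vector [fst u, snd u])"
    by (auto simp: box_def Basis_prod_def inner_prod_def Basis_vec_def forall_2 inner_axis)
  have B: "(\<Prod>b\<in>Basis. (u - l) \<bullet> b) = (fst u - fst l) * (snd u - snd l)"
    by (simp add: Basis_prod_def prod.union_disjoint inner_prod_def)
  have "emeasure (distr lborel borel (\<lambda>x :: real ^ 2. (x $ 1, x $ 2))) (box l u)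
      = emeasure lborel (box (vector [fst l, snd l] :: real ^ 2) (vector [fst u, snd u]))"
    by (simp add: emeasure_distr vimage)
  also have "\<dots> = ennreal ((fst u - fst l) * (snd u - snd l))"
    using 1 by (subst emeasure_lborel_box)
      (auto simp: Basis_vec_def forall_2 inner_axis UNIV_2 axis_eq_axis prod.insert)
  finally show "emeasure (distr lborel borel (\<lambda>x :: real ^ 2. (x $ 1, x $ 2))) (box l u)
      = (\<Prod>b\<in>Basis. (u - l) \<bullet> b)"
    by (simp add: B)
qed simp

lemma emeasure_triangle_le:
  fixes a b c :: "real \<times> real"
  shows "emeasure lborel (convex hull {a, b, c}) \<le> ennreal (norm (a - b) * norm (b - c) / 2)"
proof -
  define f where "f = (\<lambda>x :: real ^ 2. (x $ 1, x $ 2))"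
  define g where "g = (\<lambda>x :: real \<times> real. vector [fst x, snd x] :: real ^ 2)"
  have [measurable]: "f \<in> borel_measurable borel"
    unfolding f_def by (intro borel_measurable_continuous_onI continuous_intros)
  have g: "linear g"
    by (auto simp: g_def linear_iff vec_eq_iff forall_2)
  have inv: "f (g x) = x" "g (f y) = y" for x y
    by (auto simp: f_def g_def vec_eq_iff forall_2)
  have comp: "compact (convex hull {x, y, z})" for x y z :: "'a :: euclidean_space"
    by (simp add: finite_imp_compact_convex_hull)
  have "f -` (convex hull {a, b, c}) = g ` (convex hull {a, b, c})"
  proof (intro set_eqI iffI)
    fix x assume "x \<in> f -` (convex hull {a, b, c})"
    then show "x \<in> g ` (convex hull {a, b, c})"
      using imageI[of "f x" "convex hull {a, b, c}" g] by (simp add: inv)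
  qed (auto simp: inv)
  also have "\<dots> = convex hull {g b, g a, g c}"
    using convex_hull_linear_image[OF g] by (simp add: insert_commute)
  finally have vimage: "f -` (convex hull {a, b, c}) = convex hull {g b, g a, g c}" .
  have "emeasure lborel (convex hull {a, b, c}) = emeasure (distr lborel borel f) (convex hull {a, b, c})"
    unfolding f_def by (simp flip: lborel_pair_eq_distr_vec)
  also have "\<dots> = emeasure lborel (convex hull {g b, g a, g c})"
    using borel_compact[OF comp[of a b c]] by (simp add: emeasure_distr vimage)
  also have "\<dots> = ennreal (measure lborel (convex hull {g b, g a, g c}))"
    by (intro emeasure_eq_ennreal_measure) (metis comp emeasure_compact_finite less_irrefl infinity_ennreal_def)
  also have "\<dots> \<le> ennreal (norm (a - b) * norm (b - c) / 2)"
  proof (rule ennreal_leI)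
    \<comment> \<open>A determinant is at most the product of the norms, by Lagrange's identity.\<close>
    have cs: "\<bar>s * y - x * t\<bar> \<le> norm (x, y) * norm (s, t)" for x y s t :: real
    proof -
      have "(s * y - x * t)\<^sup>2 \<le> (x\<^sup>2 + y\<^sup>2) * (s\<^sup>2 + t\<^sup>2)"
        using zero_le_power2[of "x * s + y * t"] by (simp add: power2_eq_square algebra_simps)
      then show ?thesis
        by (simp add: norm_prod_def abs_le_square_iff flip: real_sqrt_mult)
          (metis real_sqrt_abs real_sqrt_le_iff)
    qed
    have "measure lborel (convex hull {g b, g a, g c})
       = \<bar>(fst c - fst b) * (snd a - snd b) - (fst a - fst b) * (snd c - snd b)\<bar> / 2"
      unfolding content_triangle by (simp add: g_def)
    also have "\<dots> \<le> norm (a - b) * norm (c - b) / 2"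
      using cs[of "fst c - fst b" "snd a - snd b" "fst a - fst b" "snd c - snd b"]
      by (simp add: norm_prod_def)
    finally show "measure lborel (convex hull {g b, g a, g c}) \<le> norm (a - b) * norm (b - c) / 2"
      by (simp add: norm_minus_commute)
  qed
  finally show ?thesis .
qed

section \<open>Deleting the points of an inscribed polygon\<close>

definition polygon_turn :: "(nat \<Rightarrow> real \<times> real) \<Rightarrow> nat \<Rightarrow> real \<times> real \<Rightarrow> real" where
  "polygon_turn x n z = (\<Sum>j<n. signed_angle (x j - z) (x (Suc j) - z))"

text \<open>
  The entry left out is \<open>x (Suc i)\<close>, which for \<open>i < n\<close> is an interior one of \<open>x 0, \<dots>, x (Suc n)\<close>. Both
  ends have to be kept: moving the base point of a closed curve may increase its \<open>p\<close>-variation.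
\<close>

definition omit :: "nat \<Rightarrow> (nat \<Rightarrow> 'a) \<Rightarrow> nat \<Rightarrow> 'a" where
  "omit i x j = (if j \<le> i then x j else x (Suc j))"

lemma sum_consecutive_omit:
  fixes f :: "'a \<Rightarrow> 'a \<Rightarrow> 'b :: ab_group_add"
  assumes "i < n"
  shows "(\<Sum>j<Suc n. f (x j) (x (Suc j))) =
    (\<Sum>j<n. f (omit i x j) (omit i x (Suc j)))
      + (f (x i) (x (Suc i)) + f (x (Suc i)) (x (Suc (Suc i))) - f (x i) (x (Suc (Suc i))))"
  using Suc_leI[OF assms]
proof (induction rule: dec_induct)
  case base
  have "(\<Sum>j<i. f (omit i x j) (omit i x (Suc j))) = (\<Sum>j<i. f (x j) (x (Suc j)))"
    by (intro sum.cong) (auto simp: omit_def)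
  then show ?case
    by (simp add: omit_def)
next
  case (step m)
  have "f (omit i x m) (omit i x (Suc m)) = f (x (Suc m)) (x (Suc (Suc m)))"
    using step.hyps by (simp add: omit_def)
  then show ?case
    using step.IH by (simp add: algebra_simps)
qed

lemma unit_partition_omit:
  assumes "unit_partition (Suc n) t" "i < n"
  shows "unit_partition n (omit i t)"
  unfolding unit_partition_def
proof (intro conjI allI impI)
  have step: "t j < t (Suc j)" if "j \<le> n" for j
    using assms(1) that by (simp add: unit_partition_def less_Suc_eq_le)
  fix j assume "j < n"
  then have "t j < t (Suc j)" "t (Suc j) < t (Suc (Suc j))"
    using step[of j] step[of "Suc j"] by simp_all
  moreover from this have "t j < t (Suc (Suc j))"
    by (rule less_trans)
  ultimately show "omit i t j < omit i t (Suc j)"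
    by (auto simp: omit_def)
qed (use assms in \<open>simp_all add: omit_def unit_partition_def\<close>)

text \<open>
  Replacing two consecutive edges by the chord \<open>a c\<close> changes the turn by the turn around the triangle
  \<open>a b c\<close>, because the chord is run through backwards in the triangle and signed angles are
  antisymmetric.
\<close>

lemma polygon_turn_omit:
  assumes "i < n"
  shows "\<bar>polygon_turn x (Suc n) z\<bar> \<le> \<bar>polygon_turn (omit i x) n z\<bar>
    + 2 * pi * of_bool (z \<in> convex hull {x i, x (Suc i), x (Suc (Suc i))})"
proof -
  define a b c where "a = x i" and "b = x (Suc i)" and "c = x (Suc (Suc i))"
  define d where "d = signed_angle (a - z) (b - z) + signed_angle (b - z) (c - z) + signed_angle (c - z) (a - z)"
  have "polygon_turn x (Suc n) z = polygon_turn (omit i x) n z + d"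
    unfolding polygon_turn_def d_def a_def b_def c_def
    using sum_consecutive_omit[OF assms, of "\<lambda>u v. signed_angle (u - z) (v - z)" x]
      signed_angle_swap[of "x (Suc (Suc i)) - z" "x i - z"] by simp
  moreover have "\<bar>d\<bar> \<le> 2 * pi * of_bool (z \<in> convex hull {a, b, c})"
    unfolding d_def using triangle_turn_le[of "a - z" "b - z" "c - z"] triangle_turn_outside[of z a b c]
    by (cases "z \<in> convex hull {a, b, c}") simp_all
  ultimately show ?thesis
    unfolding a_def b_def c_def by linarith
qed

text \<open>
  If all consecutive products exceeded \<open>(M / m)\<^sup>2\<close>, then all arithmetic means of neighbours would
  exceed \<open>M / m\<close>, because they dominate the geometric means. There are \<open>m\<close> of these means and each \<open>y j\<close> enters at most two of them, with
  weight one half, so their sum is at most \<open>M\<close>.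
\<close>

lemma exists_consecutive_product_le:
  fixes y :: "nat \<Rightarrow> real"
  assumes "m > 0" "\<And>j. j \<le> m \<Longrightarrow> y j \<ge> 0" "(\<Sum>j<Suc m. y j) \<le> M"
  shows "\<exists>i<m. y i * y (Suc i) \<le> (M / m)\<^sup>2"
proof (rule ccontr)
  assume "\<not> ?thesis"
  then have less: "(M / m)\<^sup>2 < y i * y (Suc i)" if "i < m" for i
    using that by force
  have "0 \<le> (\<Sum>j<Suc m. y j)"
    using assms(2) by (intro sum_nonneg) auto
  then have "M \<ge> 0"
    using assms(3) by linarith
  have "M = (\<Sum>i<m. M / m)"
    using assms(1) by simp
  also have "\<dots> < (\<Sum>i<m. (y i + y (Suc i)) / 2)"
  proof (rule sum_strict_mono)
    fix i assume i: "i \<in> {..<m}"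
    have "M / m = sqrt ((M / m)\<^sup>2)"
      using \<open>M \<ge> 0\<close> by simp
    also have "\<dots> < sqrt (y i * y (Suc i))"
      using less i by (intro real_sqrt_less_mono) auto
    also have "\<dots> \<le> (y i + y (Suc i)) / 2"
      using assms(2) i by (intro arith_geo_mean_sqrt) auto
    finally show "M / m < (y i + y (Suc i)) / 2" .
  qed (use assms(1) in auto)
  also have "\<dots> = ((\<Sum>i<m. y i) + (\<Sum>i<m. y (Suc i))) / 2"
    by (simp add: sum.distrib flip: sum_divide_distrib)
  also have "\<dots> \<le> M"
  proof -
    have "(\<Sum>i<m. y i) \<le> M"
      using assms(2)[of m] assms(3) by simp
    moreover have "(\<Sum>i<m. y (Suc i)) \<le> M"
      using assms(2)[of 0] assms(3) by (simp add: sum.lessThan_Suc_shift del: sum.lessThan_Suc)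
    ultimately show ?thesis
      by simp
  qed
  finally show False
    by simp
qed

text \<open>
  This is Young's deletion of points. Among the \<open>k\<close> interior points of a partition with \<open>k + 1\<close> edges,
  one has adjacent edges whose product is at most \<open>(M powr (1 / p)) ^ 2 * k powr (- (2 / p))\<close>, by the
  preceding lemma applied to the \<open>p\<close>-th powers of the edge lengths. The triangle \<open>T k\<close> spanned by
  this point and its neighbours is cut off, and the remaining points again form a partition, so the
  same \<open>M\<close> serves at each stage. With two edges left the polygon runs along a segment and back, and
  its turn is \<open>0\<close>; hence \<open>k\<close> starts at \<open>2\<close>.
\<close>

lemma polygon_turn_le_triangles:
  fixes \<gamma> :: "real \<Rightarrow> real \<times> real"
  assumes p: "p \<ge> 1" and closed: "\<gamma> 1 = \<gamma> 0"
    and M: "\<And>r t. unit_partition r t \<Longrightarrow> (\<Sum>j<r. norm (\<gamma> (t j) - \<gamma> (t (Suc j))) powr p) \<le> M"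
    and t: "unit_partition (n + 2) t"
  obtains T :: "nat \<Rightarrow> (real \<times> real) set"
  where "\<And>k. compact (T k)"
    and "\<And>k. k \<in> {2..<n + 2} \<Longrightarrow>
      emeasure lborel (T k) \<le> ennreal (1 / 2 * M powr (2 / p) * real k powr (- (2 / p)))"
    and "\<And>z. \<bar>polygon_turn (\<lambda>j. \<gamma> (t j)) (n + 2) z\<bar> \<le> 2 * pi * card {k \<in> {2..<n + 2}. z \<in> T k}"
  using t
proof (induction n arbitrary: t thesis)
  case 0
  have zero: "polygon_turn (\<lambda>j. \<gamma> (t j)) (0 + 2) z = 0" for z
    using 0(2) closed signed_angle_swap[of "\<gamma> 0 - z" "\<gamma> (t 1) - z"]
    by (simp add: polygon_turn_def numeral_2_eq_2 unit_partition_def)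
  show ?case
  proof (rule 0(1)[of "\<lambda>_. {}"])
    show "\<bar>polygon_turn (\<lambda>j. \<gamma> (t j)) (0 + 2) z\<bar> \<le> 2 * pi * card {k \<in> {2..<0 + 2}. z \<in> {}}" for z
      unfolding zero by simp
  qed auto
next
  case (Suc n)
  define m where "m = n + 2"
  have m: "m > 0" "Suc n + 2 = Suc m"
    by (auto simp: m_def)
  have "M \<ge> 0"
    by (intro order.trans[OF _ M[of 1 "\<lambda>j. real j"]]) (auto simp: unit_partition_def)
  define x where "x = (\<lambda>j. \<gamma> (t j))"
  obtain i where i: "i < m"
    and "norm (x i - x (Suc i)) powr p * norm (x (Suc i) - x (Suc (Suc i))) powr p \<le> (M / m)\<^sup>2"
    using exists_consecutive_product_le[OF m(1), of "\<lambda>j. norm (x j - x (Suc j)) powr p" M] M[OF Suc.prems(2)]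
    unfolding m(2) x_def by auto
  then have "(norm (x i - x (Suc i)) * norm (x (Suc i) - x (Suc (Suc i)))) powr p \<le> (M / m) powr 2"
    using \<open>M \<ge> 0\<close> by (simp add: powr_mult)
  then have "((norm (x i - x (Suc i)) * norm (x (Suc i) - x (Suc (Suc i)))) powr p) powr (1 / p)
      \<le> ((M / m) powr 2) powr (1 / p)"
    using p by (intro powr_mono2) auto
  then have edges: "norm (x i - x (Suc i)) * norm (x (Suc i) - x (Suc (Suc i))) \<le> M powr (2 / p) * m powr (- (2 / p))"
    using p \<open>M \<ge> 0\<close> by (simp add: powr_powr powr_divide powr_minus_divide del: powr_numeral)
  have "unit_partition (n + 2) (omit i t)"
    using unit_partition_omit[of m t i] Suc.prems(2) i unfolding m(2) by (simp add: m_def)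
  from Suc.IH[OF _ this] obtain T where T: "\<And>k. compact (T k)"
    "\<And>k. k \<in> {2..<m} \<Longrightarrow> emeasure lborel (T k) \<le> ennreal (1 / 2 * M powr (2 / p) * real k powr (- (2 / p)))"
    "\<And>z. \<bar>polygon_turn (\<lambda>j. \<gamma> (omit i t j)) m z\<bar> \<le> 2 * pi * card {k \<in> {2..<m}. z \<in> T k}"
    unfolding m_def by blast
  define T' where "T' = T(m := convex hull {x i, x (Suc i), x (Suc (Suc i))})"
  show ?case
  proof (rule Suc.prems(1)[of T'], unfold m(2))
    show "compact (T' k)" for k
      using T(1) by (simp add: T'_def finite_imp_compact_convex_hull)
    show "emeasure lborel (T' k) \<le> ennreal (1 / 2 * M powr (2 / p) * real k powr (- (2 / p)))"
      if "k \<in> {2..<Suc m}" for k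
    proof (cases "k = m")
      case True
      then show ?thesis
        unfolding T'_def using edges
        by (simp, intro order.trans[OF emeasure_triangle_le] ennreal_leI) simp
    next
      case False
      then show ?thesis
        using T(2)[of k] that by (simp add: T'_def)
    qed
    fix z
    have "{k \<in> {2..<Suc m}. z \<in> T' k}
        = {k \<in> {2..<m}. z \<in> T k} \<union> (if z \<in> T' m then {m} else {})"
      using m by (auto simp: T'_def m_def less_Suc_eq)
    then have card: "card {k \<in> {2..<Suc m}. z \<in> T' k} = card {k \<in> {2..<m}. z \<in> T k} + of_bool (z \<in> T' m)"
      by (simp add: card_insert_if)
    have omit: "omit i x = (\<lambda>j. \<gamma> (omit i t j))"
      by (auto simp: omit_def x_def)
    have "\<bar>polygon_turn x (Suc m) z\<bar> \<le> \<bar>polygon_turn (omit i x) m z\<bar> + 2 * pi * of_bool (z \<in> T' m)"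
      using polygon_turn_omit[OF i, of x z] by (simp add: T'_def)
    also have "\<dots> \<le> 2 * pi * card {k \<in> {2..<m}. z \<in> T k} + 2 * pi * of_bool (z \<in> T' m)"
      unfolding omit using T(3)[of z] by simp
    also have "\<dots> = 2 * pi * card {k \<in> {2..<Suc m}. z \<in> T' k}"
      unfolding card by (simp add: distrib_left)
    finally show "\<bar>polygon_turn (\<lambda>j. \<gamma> (t j)) (Suc m) z\<bar> \<le> 2 * pi * card {k \<in> {2..<Suc m}. z \<in> T' k}"
      by (simp add: x_def)
  qed
qed

section \<open>Sums of indicator functions in \<open>L\<^sup>q\<close>\<close>

text \<open>
  Jensen's inequality for \<open>x powr q\<close> at the points \<open>1 / w k\<close> with the weights \<open>w k / sum w K\<close>.
\<close>

lemma card_powr_le_weighted: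
  fixes w :: "'a \<Rightarrow> real"
  assumes "q \<ge> 1" "finite K" "\<And>k. k \<in> K \<Longrightarrow> w k > 0"
  shows "real (card K) powr q \<le> sum w K powr (q - 1) * (\<Sum>k\<in>K. w k powr (1 - q))"
proof (cases "K = {}")
  case False
  define W where "W = sum w K"
  have W: "W > 0"
    unfolding W_def using assms False by (intro sum_pos) auto
  have "(\<Sum>k\<in>K. (w k / W) *\<^sub>R (1 / w k)) powr q \<le> (\<Sum>k\<in>K. (w k / W) * (1 / w k) powr q)"
    using assms W False
    by (intro convex_on_sum[OF _ _ powr_convex]) (auto simp: W_def less_imp_le simp flip: sum_divide_distrib)
  also have "(\<Sum>k\<in>K. (w k / W) *\<^sub>R (1 / w k)) = (\<Sum>k\<in>K. 1 / W)"
  proof (intro sum.cong refl)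
    fix k assume "k \<in> K"
    then have "w k \<noteq> 0"
      using assms(3)[of k] by simp
    then show "(w k / W) *\<^sub>R (1 / w k) = 1 / W"
      by simp
  qed
  also have "\<dots> = card K / W"
    by simp
  also have "(card K / W) powr q = card K powr q / W powr q"
    using W by (simp add: powr_divide)
  also have "(\<Sum>k\<in>K. (w k / W) * (1 / w k) powr q) = (\<Sum>k\<in>K. w k powr (1 - q)) / W"
    unfolding sum_divide_distrib
  proof (intro sum.cong refl)
    fix k assume "k \<in> K"
    then have "w k > 0"
      using assms by auto
    then show "w k / W * (1 / w k) powr q = w k powr (1 - q) / W"
      by (simp add: powr_divide powr_diff)
  qed
  finally have "card K powr q \<le> W powr q * ((\<Sum>k\<in>K. w k powr (1 - q)) / W)"
    using W by (simp add: divide_le_eq mult.commute)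
  also have "\<dots> = W powr (q - 1) * (\<Sum>k\<in>K. w k powr (1 - q))"
    using W by (simp add: powr_diff)
  finally show ?thesis
    by (simp add: W_def)
qed simp

text \<open>
  This is Minkowski's inequality in \<open>L\<^sup>q\<close> for the indicator functions of the sets \<open>T k\<close>, whose norms are
  at most \<open>A powr (1 / q) * w k\<close>. The factor \<open>A\<close> is kept apart from the weights because it may be
  zero, whereas Jensen's inequality divides by the weights.
\<close>

lemma nn_integral_card_powr_le:
  fixes w :: "'k \<Rightarrow> real"
  assumes q: "q \<ge> 1" and K: "finite K" and w: "\<And>k. k \<in> K \<Longrightarrow> w k > 0" and A: "A \<ge> 0"
    and T: "\<And>k. k \<in> K \<Longrightarrow> T k \<in> sets M" "\<And>k. k \<in> K \<Longrightarrow> emeasure M (T k) \<le> ennreal (A * w k powr q)"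
  shows "(\<integral>\<^sup>+ z. ennreal (real (card {k \<in> K. z \<in> T k}) powr q) \<partial>M) \<le> ennreal (A * sum w K powr q)"
proof -
  define W where "W = sum w K"
  have W: "W \<ge> 0"
    unfolding W_def using w by (intro sum_nonneg less_imp_le)
  have "(\<integral>\<^sup>+ z. ennreal (real (card {k \<in> K. z \<in> T k}) powr q) \<partial>M)
      \<le> (\<integral>\<^sup>+ z. (\<Sum>k\<in>K. ennreal (W powr (q - 1) * w k powr (1 - q)) * indicator (T k) z) \<partial>M)"
  proof (intro nn_integral_mono)
    fix z
    define L where "L = {k \<in> K. z \<in> T k}"
    have "real (card L) powr q \<le> sum w L powr (q - 1) * (\<Sum>k\<in>L. w k powr (1 - q))"
      using q K w by (intro card_powr_le_weighted) (auto simp: L_def)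
    also have "\<dots> \<le> W powr (q - 1) * (\<Sum>k\<in>L. w k powr (1 - q))"
    proof (intro mult_right_mono powr_mono2)
      show "sum w L \<le> W" "0 \<le> sum w L"
        unfolding W_def L_def using K w by (auto intro!: sum_mono2 sum_nonneg intro: less_imp_le)
    qed (use q in \<open>auto intro: sum_nonneg\<close>)
    also have "\<dots> = (\<Sum>k\<in>K. W powr (q - 1) * w k powr (1 - q) * indicator (T k) z)"
      unfolding sum_distrib_left L_def sum.inter_filter[OF K]
      by (intro sum.cong) (auto simp: indicator_def)
    finally have "ennreal (real (card L) powr q) \<le> ennreal (\<Sum>k\<in>K. W powr (q - 1) * w k powr (1 - q) * indicator (T k) z)"
      by (rule ennreal_leI)
    also have "\<dots> = (\<Sum>k\<in>K. ennreal (W powr (q - 1) * w k powr (1 - q)) * indicator (T k) z)"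
      by (subst sum_ennreal [symmetric]) (auto simp: ennreal_mult' ennreal_indicator intro!: sum.cong)
    finally show "ennreal (real (card {k \<in> K. z \<in> T k}) powr q)
        \<le> (\<Sum>k\<in>K. ennreal (W powr (q - 1) * w k powr (1 - q)) * indicator (T k) z)"
      by (simp add: L_def)
  qed
  also have "\<dots> = (\<Sum>k\<in>K. ennreal (W powr (q - 1) * w k powr (1 - q)) * emeasure M (T k))"
    using T(1) by (simp add: nn_integral_sum nn_integral_cmult)
  also have "\<dots> \<le> (\<Sum>k\<in>K. ennreal (W powr (q - 1) * A * w k))"
  proof (intro sum_mono)
    fix k assume k: "k \<in> K"
    have "ennreal (W powr (q - 1) * w k powr (1 - q)) * emeasure M (T k)
        \<le> ennreal (W powr (q - 1) * w k powr (1 - q)) * ennreal (A * w k powr q)"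
      using T(2)[OF k] by (intro mult_left_mono) auto
    also have "\<dots> = ennreal (W powr (q - 1) * A * (w k powr (1 - q) * w k powr q))"
      using A by (simp add: mult_ac flip: ennreal_mult)
    also have "w k powr (1 - q) * w k powr q = w k"
      using w[OF k] by (simp flip: powr_add)
    finally show "ennreal (W powr (q - 1) * w k powr (1 - q)) * emeasure M (T k)
        \<le> ennreal (W powr (q - 1) * A * w k)" .
  qed
  also have "\<dots> = ennreal (\<Sum>k\<in>K. W powr (q - 1) * A * w k)"
    using A w by (intro sum_ennreal mult_nonneg_nonneg) (auto intro: less_imp_le)
  also have "(\<Sum>k\<in>K. W powr (q - 1) * A * w k) = A * W powr q"
  proof -
    have "(\<Sum>k\<in>K. W powr (q - 1) * A * w k) = W powr (q - 1) * A * W"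
      by (simp add: W_def sum_distrib_left)
    also have "\<dots> = A * W powr q"
      using W by (cases "W = 0") (simp_all add: powr_diff)
    finally show ?thesis .
  qed
  finally show ?thesis
    by (simp add: W_def)
qed

section \<open>Winding numbers of continuous curves\<close>

text \<open>
  A lift of the angle is uniformly continuous. Once the mesh of the partition is so small that the lift
  changes by less than \<open>\<pi>\<close> on each interval, the signed angle of each chord is the increment of the
  lift itself, and these increments telescope. In particular no homotopy between the curve and the
  polygon has to be considered.
\<close>

lemma planar_winding_number_eventually_polygon_turn:
  assumes "path \<gamma>" "z \<notin> path_image \<gamma>"
  shows "\<forall>\<^sub>F n in sequentially. planar_winding_number \<gamma> z = polygon_turn (\<lambda>j. \<gamma> (j / n)) n z / (2 * pi)"
proof -
  obtain \<theta> where \<theta>: "angle_lift \<gamma> z \<theta>"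
    using angle_lift_exists[OF assms] by blast
  define \<rho> where "\<rho> = (\<lambda>t. norm (\<gamma> t - z))"
  have \<rho>: "\<rho> t > 0" "\<gamma> t - z = (\<rho> t * cos (\<theta> t), \<rho> t * sin (\<theta> t))" if "t \<in> {0..1}" for t
  proof -
    show pos: "\<rho> t > 0"
      using assms(2) that by (auto simp: \<rho>_def path_image_def)
    have "\<gamma> t - z = \<rho> t *\<^sub>R ((\<gamma> t - z) /\<^sub>R norm (\<gamma> t - z))"
      using pos by (simp add: \<rho>_def)
    also have "(\<gamma> t - z) /\<^sub>R norm (\<gamma> t - z) = (cos (\<theta> t), sin (\<theta> t))"
      using \<theta> that unfolding angle_lift_def by blast
    finally show "\<gamma> t - z = (\<rho> t * cos (\<theta> t), \<rho> t * sin (\<theta> t))"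
      by simp
  qed
  have "uniformly_continuous_on {0..1} \<theta>"
    using \<theta> by (intro compact_uniformly_continuous) (auto simp: angle_lift_def)
  then obtain \<delta> where "\<delta> > 0"
    and \<delta>: "\<And>s t. s \<in> {0..1} \<Longrightarrow> t \<in> {0..1} \<Longrightarrow> \<bar>t - s\<bar> < \<delta> \<Longrightarrow> \<bar>\<theta> t - \<theta> s\<bar> < pi"
    unfolding uniformly_continuous_on_def dist_real_def using pi_gt_zero by metis
  have "(\<lambda>n. 1 / real n) \<longlonglongrightarrow> 0"
    by (rule lim_1_over_n)
  then have "\<forall>\<^sub>F n in sequentially. 1 / real n < \<delta>"
    using \<open>\<delta> > 0\<close> by (rule order_tendstoD(2))
  then show ?thesis
    using eventually_gt_at_top[of 0]
  proof eventually_elim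
    case (elim n)
    have "polygon_turn (\<lambda>j. \<gamma> (j / n)) n z = (\<Sum>j<n. \<theta> (Suc j / n) - \<theta> (j / n))"
      unfolding polygon_turn_def
    proof (intro sum.cong refl)
      fix j assume "j \<in> {..<n}"
      then have in01: "j / n \<in> {0..1}" "Suc j / n \<in> {0..1}"
        by auto
      have "\<bar>Suc j / n - j / n\<bar> < \<delta>"
        using elim by (simp add: add_divide_distrib)
      from \<delta>[OF in01 this] show "signed_angle (\<gamma> (j / n) - z) (\<gamma> (Suc j / n) - z) = \<theta> (Suc j / n) - \<theta> (j / n)"
        using in01 by (simp add: \<rho> signed_angle_polar_eq del: of_nat_Suc)
    qed
    also have "\<dots> = \<theta> (n / n) - \<theta> (0 / n)"
      using sum_lessThan_telescope[of "\<lambda>j. \<theta> (j / n)" n] by simp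
    finally show ?case
      using elim by (simp add: planar_winding_number_eq[OF \<theta>])
  qed
qed

lemma borel_measurable_polygon_turn [measurable]: "polygon_turn x n \<in> borel_measurable borel"
proof -
  have [measurable]: "(arctan :: real \<Rightarrow> real) \<in> borel_measurable borel"
    by (intro borel_measurable_continuous_onI continuous_intros)
  have [measurable]: "(\<lambda>z. fst (a - z) * snd (b - z) - snd (a - z) * fst (b - z)) \<in> borel_measurable borel"
    "(\<lambda>z. norm (a - z) * norm (b - z) + (a - z) \<bullet> (b - z)) \<in> borel_measurable borel" for a b :: "real \<times> real"
    by (intro borel_measurable_continuous_onI continuous_intros)+
  show ?thesis
    unfolding polygon_turn_def signed_angle_def by measurable
qed

section \<open>The integral bound\<close>

lemma sum_powr_le_zeta_real:
  assumes "s > 1"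
  shows "(\<Sum>k\<in>{2..<n + 2}. real k powr (- s)) \<le> zeta_real s - 1"
proof -
  define f where "f = (\<lambda>j. 1 / real (Suc j) powr s)"
  have "summable (\<lambda>j. real (Suc j) powr (- s))"
    using assms by (subst summable_Suc_iff) (simp add: summable_real_powr_iff)
  then have f: "summable f"
    by (simp add: f_def powr_minus_divide)
  have "(\<Sum>k\<in>{2..<n + 2}. real k powr (- s)) = (\<Sum>j\<in>{1..<n + 1}. f j)"
    by (rule sum.reindex_bij_witness[of _ Suc "\<lambda>k. k - 1"]) (auto simp: f_def powr_minus_divide)
  also have "1 + (\<Sum>j\<in>{1..<n + 1}. f j) = (\<Sum>j\<in>insert 0 {1..<n + 1}. f j)"
    by (simp add: f_def)
  also have "\<dots> \<le> suminf f"
    by (intro sum_le_suminf f) (auto simp: f_def)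
  finally show ?thesis
    by (simp add: zeta_real_def f_def)
qed

text \<open>
  The bound \<open>1 / 2 * M powr (2 / p) * k powr (- (2 / p))\<close> for the area of the \<open>k\<close>-th triangle contains
  the \<open>q\<close>-th power of the weight \<open>k powr (- (2 / (p * q)))\<close>, and the sum of these weights over \<open>k \<ge> 2\<close>
  is the zeta value minus one. The condition \<open>q < 2 / p\<close> says that the series converges.
\<close>

lemma nn_integral_polygon_turn_le:
  fixes \<gamma> :: "real \<Rightarrow> real \<times> real"
  assumes p: "p \<ge> 1" and q: "1 \<le> q" "q < 2 / p" and closed: "\<gamma> 1 = \<gamma> 0"
    and M: "\<And>r t. unit_partition r t \<Longrightarrow> (\<Sum>j<r. norm (\<gamma> (t j) - \<gamma> (t (Suc j))) powr p) \<le> M"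
    and t: "unit_partition (n + 2) t"
  shows "(\<integral>\<^sup>+ z. ennreal ((\<bar>polygon_turn (\<lambda>j. \<gamma> (t j)) (n + 2) z\<bar> / (2 * pi)) powr q) \<partial>lborel)
    \<le> ennreal (1 / 2 * M powr (2 / p) * (zeta_real (2 / (p * q)) - 1) powr q)"
proof -
  define s where "s = 2 / (p * q)"
  have s: "s > 1"
    using p q by (simp add: s_def less_divide_eq mult.commute)
  have w: "real k powr (- (2 / p)) = (real k powr (- s)) powr q" for k
    using q by (simp add: s_def powr_powr)
  obtain T where T: "\<And>k. compact (T k)"
    "\<And>k. k \<in> {2..<n + 2} \<Longrightarrow>
      emeasure lborel (T k) \<le> ennreal (1 / 2 * M powr (2 / p) * (real k powr (- s)) powr q)"
    "\<And>z. \<bar>polygon_turn (\<lambda>j. \<gamma> (t j)) (n + 2) z\<bar> \<le> 2 * pi * card {k \<in> {2..<n + 2}. z \<in> T k}"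
    using polygon_turn_le_triangles[OF p closed M t] unfolding w by blast
  have "(\<integral>\<^sup>+ z. ennreal ((\<bar>polygon_turn (\<lambda>j. \<gamma> (t j)) (n + 2) z\<bar> / (2 * pi)) powr q) \<partial>lborel)
      \<le> (\<integral>\<^sup>+ z. ennreal (real (card {k \<in> {2..<n + 2}. z \<in> T k}) powr q) \<partial>lborel)"
    using T(3) q by (intro nn_integral_mono ennreal_leI powr_mono2) (auto simp: divide_le_eq mult.commute)
  also have "\<dots> \<le> ennreal (1 / 2 * M powr (2 / p) * (\<Sum>k\<in>{2..<n + 2}. real k powr (- s)) powr q)"
    using T(1,2) q by (intro nn_integral_card_powr_le) (auto intro: borel_compact)
  also have "\<dots> \<le> ennreal (1 / 2 * M powr (2 / p) * (zeta_real s - 1) powr q)"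
    using sum_powr_le_zeta_real[OF s, of n] q
    by (intro ennreal_leI mult_left_mono powr_mono2) (simp_all add: sum_nonneg del: sum.op_ivl_Suc)
  finally show ?thesis
    by (simp add: s_def)
qed

theorem theorem1p1:
  fixes p q :: real and \<gamma> :: "real \<Rightarrow> real \<times> real"
  assumes "1 \<le> p" and "p < 2"
    and "path \<gamma>" and "pathfinish \<gamma> = pathstart \<gamma>"
    and "finite_p_variation p \<gamma>"
    and "1 \<le> q" and "q < 2 / p"
  shows "set_integrable lborel (- path_image \<gamma>) (\<lambda>(x, y). \<bar>planar_winding_number \<gamma> (x, y)\<bar> powr q) \<and>
    (LINT (x, y):(- path_image \<gamma>)|lborel. \<bar>planar_winding_number \<gamma> (x, y)\<bar> powr q) powr (1 / q)
      \<le> (1 / 2) powr (1 / q) * (zeta_real (2 / (p * q)) - 1) * p_variation p \<gamma> powr (2 / q)"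
proof -
  define M where "M = Sup (variation_sums p \<gamma>)"
  have M: "(\<Sum>j<r. norm (\<gamma> (t j) - \<gamma> (t (Suc j))) powr p) \<le> M" if "unit_partition r t" for r t
    unfolding M_def using assms(5) that
    by (intro cSup_upper) (auto simp: finite_p_variation_def variation_sums_def)
  define Z where "Z = zeta_real (2 / (p * q)) - 1"
  have "2 / (p * q) > 1"
    using assms by (simp add: less_divide_eq mult.commute)
  then have Z: "Z \<ge> 0"
    unfolding Z_def using sum_powr_le_zeta_real[of "2 / (p * q)" 0] by simp
  define C where "C = 1 / 2 * M powr (2 / p) * Z powr q"
  define S where "S = - path_image \<gamma>"
  have [measurable]: "S \<in> sets borel"
    unfolding S_def using assms(3) by (simp add: closed_path_image borel_comp borel_closed)
  define f where "f = (\<lambda>z. indicator S z * \<bar>planar_winding_number \<gamma> z\<bar> powr q)"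
  define g where "g = (\<lambda>n z. indicator S z *
    (\<bar>polygon_turn (\<lambda>j. \<gamma> (j / real (n + 2))) (n + 2) z\<bar> / (2 * pi)) powr q)"
  have g_meas [measurable]: "g n \<in> borel_measurable borel" for n
    unfolding g_def by measurable
  have lim: "(\<lambda>n. g n z) \<longlonglongrightarrow> f z" for z
  proof (cases "z \<in> S")
    case True
    then have "\<forall>\<^sub>F n in sequentially. planar_winding_number \<gamma> z = polygon_turn (\<lambda>j. \<gamma> (j / real n)) n z / (2 * pi)"
      using planar_winding_number_eventually_polygon_turn[OF assms(3)] by (simp add: S_def)
    then have "\<forall>\<^sub>F n in sequentially. planar_winding_number \<gamma> z
        = polygon_turn (\<lambda>j. \<gamma> (j / real (n + 2))) (n + 2) z / (2 * pi)"
      by (rule sequentially_offset)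
    then have "\<forall>\<^sub>F n in sequentially. g n z = f z"
      by eventually_elim (simp add: f_def g_def)
    then show ?thesis
      by (rule tendsto_eventually)
  qed (simp add: f_def g_def)
  have f_meas [measurable]: "f \<in> borel_measurable borel"
    by (rule borel_measurable_LIMSEQ_real[OF lim g_meas])
  have bound: "(\<integral>\<^sup>+ z. ennreal (g n z) \<partial>lborel) \<le> ennreal C" for n
  proof -
    have "unit_partition (n + 2) (\<lambda>j. j / real (n + 2))"
      by (auto simp: unit_partition_def divide_strict_right_mono)
    from nn_integral_polygon_turn_le[OF assms(1,6,7) _ M this]
    have "(\<integral>\<^sup>+ z. ennreal ((\<bar>polygon_turn (\<lambda>j. \<gamma> (j / real (n + 2))) (n + 2) z\<bar> / (2 * pi)) powr q) \<partial>lborel) \<le> ennreal C"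
      using assms(4) by (simp add: C_def Z_def pathstart_def pathfinish_def)
    moreover have "(\<integral>\<^sup>+ z. ennreal (g n z) \<partial>lborel)
      \<le> (\<integral>\<^sup>+ z. ennreal ((\<bar>polygon_turn (\<lambda>j. \<gamma> (j / real (n + 2))) (n + 2) z\<bar> / (2 * pi)) powr q) \<partial>lborel)"
      by (intro nn_integral_mono ennreal_leI) (auto simp: g_def indicator_def)
    ultimately show ?thesis
      by (rule order.trans[rotated])
  qed
  \<comment> \<open>Fatou's lemma carries the bound from the polygons to the curve.\<close>
  have "(\<integral>\<^sup>+ z. ennreal (f z) \<partial>lborel) = (\<integral>\<^sup>+ z. liminf (\<lambda>n. ennreal (g n z)) \<partial>lborel)"
    by (intro nn_integral_cong lim_imp_Liminf [symmetric] tendsto_ennrealI lim) simp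
  also have "\<dots> \<le> liminf (\<lambda>n. \<integral>\<^sup>+ z. ennreal (g n z) \<partial>lborel)"
    by (rule nn_integral_liminf) simp
  also have "\<dots> \<le> liminf (\<lambda>n. ennreal C)"
    by (intro Liminf_mono always_eventually allI bound)
  also have "\<dots> = ennreal C"
    by (simp add: Liminf_const)
  finally have fC: "(\<integral>\<^sup>+ z. ennreal (f z) \<partial>lborel) \<le> ennreal C" .
  have f_nonneg: "f z \<ge> 0" for z
    by (simp add: f_def)
  have int: "integrable lborel f"
    using fC f_nonneg by (intro integrableI_bounded) (auto simp: le_less_trans)
  have "integral\<^sup>L lborel f \<le> C"
    using fC by (intro integral_real_bounded) (auto simp: C_def)
  then have "integral\<^sup>L lborel f powr (1 / q) \<le> C powr (1 / q)"
    using assms(6) f_nonneg by (intro powr_mono2) (auto intro: integral_nonneg)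
  also have "C powr (1 / q) = (1 / 2) powr (1 / q) * Z * (M powr (1 / p)) powr (2 / q)"
    using Z assms(1,6) unfolding C_def by (simp add: powr_mult powr_divide powr_powr mult.commute)
  finally have "integral\<^sup>L lborel f powr (1 / q) \<le> (1 / 2) powr (1 / q) * Z * p_variation p \<gamma> powr (2 / q)"
    by (simp add: p_variation_def M_def)
  then show ?thesis
    using int unfolding set_integrable_def set_lebesgue_integral_def case_prod_eta
    by (simp add: f_def S_def Z_def)
qed

end
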